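(* Modulo the action of $S_3$ on the colors, there are $c(n)$ acceptable color vectors for the set of trees with $n$ carets, where $c(0)=0$, $c(1)=1$, and $c(n+1)=2c(n)+3c(n-1)+1$ for $n\ge1$.
   Context: Finite binary trees are rooted, planar; every vertex has $0$ or two (ordered) children except the root, which has degree $1$ and a single child. A tree with $n$ carets is a tree with $n$ internal vertices (vertices of degree $3$), hence with $n+1$ leaves, numbered left to right. Colors are elements of $\mathbb Z_2\times\mathbb Z_2$, coded $0=(0,0)$, $1=(0,1)$, $2=(1,0)$, $3=(1,1)$. A color vector $\mathbf c=(c_1,\dots,c_{n+1})$ for such a tree determines the unique edge coloring in which the edge at the $i$-th leaf has color $c_i$ and the three edges at each internal vertex sum to $0$. It is valid for the tree if this is a proper edge coloring using only colors $1,2,3$. A color vector is acceptable if it is valid for some finite binary tree with the corresponding number of leaves. $S_3$ acts on vectors by permuting the colors $1,2,3$. For $n\ge1$, $c(n)$ is the number of $S_3$-orbits of acceptable color vectors of length $n+1$ (equivalently, of non-constant vectors of length $n+1$ in $\{1,2,3\}$ with non-zero sum); $c(0)$ is set equal to $0$ (the constant vectors of length $1$ are not counted). *)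

theory Defs
  imports
    "HOL-Library.Tree"
    "HOL-Library.Z2"
    "HOL-Library.Product_Plus"
    "HOL-Combinatorics.Permutations"
begin

text \<open>
  A \<open>unit tree\<close> is the part of the rooted tree below its root: the root, which has degree 1, is
  left implicit, together with the edge joining it to its single child. Thus \<^term>\<open>size t\<close> is
  the number of carets, and \<^term>\<open>Leaf\<close> is the tree with one leaf and one edge.

  Vertices other than the root are addressed by their path from the child of the root
  (\<^term>\<open>False\<close> = left, \<^term>\<open>True\<close> = right).
\<close>

type_synonym bintree = "unit tree"
type_synonym address = "bool list"

fun leaves :: "bintree \<Rightarrow> address list" where
  "leaves Leaf = [[]]"
| "leaves (Node l _ r) = map ((#) False) (leaves l) @ map ((#) True) (leaves r)"

fun internal :: "bintree \<Rightarrow> address set" where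
  "internal Leaf = {}"
| "internal (Node l _ r) = insert [] ((#) False ` internal l \<union> (#) True ` internal r)"

text \<open>Every vertex other than the root stands for the edge joining it to its parent.\<close>

definition edges :: "bintree \<Rightarrow> address set" where
  "edges t = set (leaves t) \<union> internal t"

text \<open>The edges at the vertex \<open>v\<close>: the one above it and those to its children.\<close>

definition incident :: "bintree \<Rightarrow> address \<Rightarrow> address set" where
  "incident t v = {e \<in> edges t. e = v \<or> (e \<noteq> [] \<and> butlast e = v)}"

type_synonym color = "bit \<times> bit"

definition color1 :: color where "color1 = (0, 1)"
definition color2 :: color where "color2 = (1, 0)"
definition color3 :: color where "color3 = (1, 1)"

definition colors123 :: "color set" where
  "colors123 = {color1, color2, color3}"

text \<open>
  \<open>f\<close> is the edge coloring of \<open>t\<close> determined by \<open>c\<close>; only its values on \<^term>\<open>edges t\<close> matter.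
\<close>

definition induced_coloring :: "bintree \<Rightarrow> color list \<Rightarrow> (address \<Rightarrow> color) \<Rightarrow> bool" where
  "induced_coloring t c f \<longleftrightarrow>
     map f (leaves t) = c \<and> (\<forall>v \<in> internal t. (\<Sum>e \<in> incident t v. f e) = 0)"

text \<open>The implicit root has degree 1, so it imposes no condition.\<close>

definition proper_coloring :: "bintree \<Rightarrow> (address \<Rightarrow> color) \<Rightarrow> bool" where
  "proper_coloring t f \<longleftrightarrow> (\<forall>v \<in> edges t. inj_on f (incident t v))"

definition valid :: "bintree \<Rightarrow> color list \<Rightarrow> bool" where
  "valid t c \<longleftrightarrow> length c = size t + 1 \<and>
     (\<exists>f. induced_coloring t c f \<and> proper_coloring t f \<and> f ` edges t \<subseteq> colors123)"

definition acceptable :: "color list \<Rightarrow> bool" where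
  "acceptable c \<longleftrightarrow> (\<exists>t. valid t c)"

definition S3_orbit :: "color list \<Rightarrow> color list set" where
  "S3_orbit c = {map \<sigma> c | \<sigma>. \<sigma> permutes colors123}"

text \<open>
  The value at 0 is a convention: the constant vectors of length 1, although valid for the
  tree without carets, are not counted.
\<close>

definition num_acceptable :: "nat \<Rightarrow> nat" where
  "num_acceptable n =
     (if n = 0 then 0 else card (S3_orbit ` {c. length c = n + 1 \<and> acceptable c}))"

lemma leaves_internal_disjoint: "set (leaves t) \<inter> internal t = {}"
  by (induction t) auto

lemma length_leaves: "length (leaves t) = size t + 1"
  by (induction t) auto

lemma distinct_leaves: "distinct (leaves t)"
  by (induction t) (auto simp: distinct_map)

lemma Nil_in_edges: "[] \<in> edges t"
  by (cases t) (auto simp: edges_def)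

lemma edges_Node:
  "edges (Node l u r) = insert [] ((#) False ` edges l \<union> (#) True ` edges r)"
  by (auto simp: edges_def)

lemma children_in_edges: "v \<in> internal t \<Longrightarrow> v @ [b] \<in> edges t \<and> v \<in> edges t"
  by (induction t arbitrary: v) (auto simp: edges_Node Nil_in_edges, (cases b; simp add: Nil_in_edges)+)

lemma incident_internal:
  assumes "v \<in> internal t"
  shows "incident t v = {v, v @ [False], v @ [True]}"
proof -
  have "e = v @ [False] \<or> e = v @ [True]" if "e \<noteq> []" "butlast e = v" for e
    using that append_butlast_last_id[of e] by (cases "last e") metis+
  then show ?thesis
    using children_in_edges[OF assms] by (auto simp: incident_def)
qed

lemma induced_coloring_iff:
  "induced_coloring t c f \<longleftrightarrow>
     map f (leaves t) = c \<and> (\<forall>v \<in> internal t. f v + f (v @ [False]) + f (v @ [True]) = 0)"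
  by (simp add: induced_coloring_def incident_internal add.assoc)

lemma induced_coloring_Node:
  "induced_coloring (Node l u r) (c @ d) f \<longleftrightarrow>
     induced_coloring l c (\<lambda>e. f (False # e)) \<and> induced_coloring r d (\<lambda>e. f (True # e)) \<and>
     f [] + f [False] + f [True] = 0"
  if "length c = size l + 1"
  using that by (auto simp: induced_coloring_iff ball_Un length_leaves o_def append_eq_append_conv)

lemma induced_coloring_ex:
  "length c = size t + 1 \<Longrightarrow> \<exists>f. induced_coloring t c f"
proof (induction t arbitrary: c)
  case Leaf
  then obtain x where "c = [x]" by (cases c) auto
  then show ?case by (auto simp: induced_coloring_iff)
next
  case (Node l u r)
  define a b where "a = take (size l + 1) c" and "b = drop (size l + 1) c"
  have len: "length a = size l + 1" "length b = size r + 1" and c: "c = a @ b"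
    using Node.prems by (auto simp: a_def b_def)
  from Node.IH len obtain f g where f: "induced_coloring l a f" and g: "induced_coloring r b g"
    by blast
  define h where "h e = (case e of [] \<Rightarrow> - (f [] + g []) | b # e' \<Rightarrow> (if b then g e' else f e'))" for e
  have "induced_coloring (Node l u r) (a @ b) h"
    using f g by (simp add: induced_coloring_Node[OF len(1)] h_def)
  then show ?case using c by blast
qed

lemma induced_coloring_unique:
  "induced_coloring t c f \<Longrightarrow> induced_coloring t c g \<Longrightarrow> e \<in> edges t \<Longrightarrow> f e = g e"
proof (induction t arbitrary: c f g e)
  case Leaf
  then show ?case by (auto simp: induced_coloring_iff edges_def)
next
  case (Node l u r)
  have "length c = size l + 1 + (size r + 1)"
    using Node.prems(1) length_leaves[of "Node l u r"] by (auto simp: induced_coloring_iff length_leaves)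
  then obtain a b where c: "c = a @ b" and len: "length a = size l + 1"
    by (metis append_take_drop_id length_take le_add1 min.absorb2)
  note ind = Node.prems(1,2)[unfolded c induced_coloring_Node[OF len]]
  have L: "f (False # e') = g (False # e')" if "e' \<in> edges l" for e'
    using Node.IH(1)[of a "\<lambda>e. f (False # e)" "\<lambda>e. g (False # e)"] ind that by blast
  have R: "f (True # e') = g (True # e')" if "e' \<in> edges r" for e'
    using Node.IH(2)[of b "\<lambda>e. f (True # e)" "\<lambda>e. g (True # e)"] ind that by blast
  have "f [] = g []"
    using ind L[OF Nil_in_edges] R[OF Nil_in_edges] by (metis add_right_cancel)
  then show ?case using Node.prems(3) L R by (auto simp: edges_Node)
qed

end

theory Submission
  imports Defs
begin

text \<open>
  Addition of colors satisfies \<open>x + x = 0\<close>, so the coloring induced by \<open>c\<close> gives each edge the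
  sum of the entries of \<open>c\<close> at the leaves below it. Three colors with sum \<open>0\<close> are distinct as soon
  as they are non-zero; hence \<open>c\<close> is valid for \<open>t\<close> exactly when no edge gets the color \<open>0\<close>
  (\<open>valid_iff_nonzero\<close>).

  This describes the acceptable vectors: besides the non-zero vectors of length 1 they are the
  vectors over \<open>{1, 2, 3}\<close> that are not constant and have non-zero sum. These conditions are
  necessary because the edge at the root carries the total, and because a constant vector that is split at
  the root would force two equal edges below it (\<open>valid_imp\<close>). Conversely, replace two adjacent
  distinct entries \<open>x\<close>, \<open>y\<close> by the single entry \<open>x + y\<close>. The total does not change, and the
  pair can be chosen so that the shorter vector has length 1 or is again not constant
  (\<open>ex_good_merge\<close>). A tree for
  the shorter vector gives one for the longer vector when a caret is attached to the leaf \<open>x + y\<close>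
  (\<open>acceptable_graft\<close>).

  Every permutation of \<open>{1, 2, 3}\<close> extends to an automorphism of the group of colors, so
  \<open>S\<^sub>3\<close> acts on these vectors, and it acts freely because two distinct entries determine
  the permutation. Thus six times the number of orbits is the number of vectors
  (\<open>num_acceptable_card\<close>). Finally let \<open>N m\<close> be the number of vectors of length \<open>m\<close> over
  \<open>{1, 2, 3}\<close> with non-zero sum. A vector with sum \<open>0\<close> is determined by its tail, whose sum is its
  first entry, so \<open>N (m + 1) + N m = 3 ^ (m + 1)\<close>. Eliminating the powers of \<open>3\<close> from two
  consecutive instances gives \<open>N (m + 2) = 2 N (m + 1) + 3 N m\<close>. The constant vectors counted by
  \<open>N m\<close> number \<open>3\<close> if \<open>m\<close> is odd and \<open>0\<close> otherwise; removing them contributes the summand \<open>1\<close>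
  of the recurrence.
\<close>

section \<open>Arithmetic of the colors\<close>

text \<open>
  From here on colors are elements of the Klein four-group, and quantifiers over them
  should not be split into quantifiers over bits.
\<close>

declare split_paired_Ex [simp del] split_paired_All [simp del]

lemma colors123_eq: "colors123 = - {0}"
proof -
  have "x = (0, 0) \<or> x = (0, 1) \<or> x = (1, 0) \<or> x = (1, 1)" for x :: color
    by (cases x; cases "fst x"; cases "snd x") auto
  then show ?thesis
    by (auto simp: colors123_def color1_def color2_def color3_def zero_prod_def)
qed

lemma card_colors123: "card colors123 = 3" "finite colors123"
  by (auto simp: colors123_def color1_def color2_def color3_def)

lemma color_add_self [simp]: "x + x = (0 :: color)"
  by (cases x) (simp add: zero_prod_def)

lemma color_add_eq_0_iff: "x + y = 0 \<longleftrightarrow> x = (y :: color)"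
  by (metis add.assoc add_0_left add_0_right color_add_self)

lemma color_add_add [simp]: "x + (x + y) = (y :: color)"
  by (simp flip: add.assoc)

text \<open>
  The three non-zero colors sum to 0: \<open>x + y\<close> is a non-zero color other than \<open>x\<close> and \<open>y\<close>, and
  only one such color is left.
\<close>

lemma third_color:
  assumes "x \<noteq> 0" "y \<noteq> 0" "z \<noteq> 0" "x \<noteq> y" "x \<noteq> z" "y \<noteq> z"
  shows "x + y = (z :: color)"
proof -
  have "{x, y, z} = colors123"
  proof (intro card_subset_eq)
    show "{x, y, z} \<subseteq> colors123" using assms by (simp add: colors123_eq)
  qed (use assms in \<open>simp_all add: card_colors123\<close>)
  moreover have "x + y \<in> colors123" "x + y \<noteq> x" "x + y \<noteq> y"
    using assms by (auto simp: colors123_eq color_add_eq_0_iff)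
  ultimately show ?thesis by blast
qed

lemma sum_list_replicate_color:
  "sum_list (replicate m (x :: color)) = (if even m then 0 else x)"
  by (induction m) auto

section \<open>Valid vectors, recursively along the tree\<close>

lemma butlast_edge_internal: "e \<in> edges t \<Longrightarrow> e \<noteq> [] \<Longrightarrow> butlast e \<in> internal t"
  by (induction t arbitrary: e) (auto simp: edges_Node, simp_all add: edges_def)

lemma incident_leaf:
  assumes "v \<in> set (leaves t)"
  shows "incident t v = {v}"
  using assms butlast_edge_internal leaves_internal_disjoint[of t]
  by (fastforce simp: incident_def edges_def)

text \<open>
  Properness follows from non-zero colors alone: if the edges at an internal vertex sum to 0 and
  two of them agree, then the third one has color 0.
\<close>

lemma valid_iff_nonzero:
  "valid t c \<longleftrightarrow> length c = size t + 1 \<and> (\<exists>f. induced_coloring t c f \<and> (\<forall>e \<in> edges t. f e \<noteq> 0))"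
proof -
  have "proper_coloring t f" if ind: "induced_coloring t c f" and nz: "\<forall>e \<in> edges t. f e \<noteq> 0" for f
  proof (unfold proper_coloring_def, rule ballI)
    fix v assume "v \<in> edges t"
    then consider "v \<in> set (leaves t)" | "v \<in> internal t" by (auto simp: edges_def)
    then show "inj_on f (incident t v)"
    proof cases
      case 1
      then show ?thesis by (simp add: incident_leaf)
    next
      case 2
      define a b where "a = f (v @ [False])" and "b = f (v @ [True])"
      have "f v \<noteq> 0" "a \<noteq> 0" "b \<noteq> 0"
        using children_in_edges[OF 2] nz by (auto simp: a_def b_def)
      moreover have "f v = a + b"
        using ind 2 by (auto simp: induced_coloring_iff a_def b_def add.assoc color_add_eq_0_iff)
      ultimately have "f v \<noteq> a" "f v \<noteq> b" "a \<noteq> b" by auto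
      then show ?thesis
        by (auto simp: incident_internal[OF 2] a_def b_def)
    qed
  qed
  then show ?thesis by (auto simp: valid_def colors123_eq)
qed

text \<open>
  At each vertex the upper edge is the sum of the two lower ones, so on the way up to the root the
  colors of the leaves accumulate.
\<close>

lemma induced_coloring_root: "induced_coloring t c f \<Longrightarrow> f [] = sum_list c"
proof (induction t arbitrary: c f)
  case Leaf
  then show ?case by (auto simp: induced_coloring_iff)
next
  case (Node l u r)
  define a b where "a = take (size l + 1) c" and "b = drop (size l + 1) c"
  have len: "length a = size l + 1" and c: "c = a @ b"
    using Node.prems length_leaves[of "Node l u r"]
    by (auto simp: a_def b_def induced_coloring_iff length_leaves)
  have "f [False] = sum_list a" "f [True] = sum_list b" "f [] + f [False] + f [True] = 0"
    using Node.prems Node.IH(1)[of a "\<lambda>e. f (False # e)"] Node.IH(2)[of b "\<lambda>e. f (True # e)"]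
    unfolding c induced_coloring_Node[OF len] by auto
  then show ?case by (simp add: c add.assoc color_add_eq_0_iff)
qed

lemma valid_Leaf: "valid Leaf c \<longleftrightarrow> (\<exists>x. c = [x] \<and> x \<noteq> 0)"
proof
  assume "valid Leaf c"
  then show "\<exists>x. c = [x] \<and> x \<noteq> 0"
    by (auto simp: valid_iff_nonzero edges_def induced_coloring_iff)
next
  assume "\<exists>x. c = [x] \<and> x \<noteq> 0"
  then obtain x where "c = [x]" "x \<noteq> 0" by blast
  then have "induced_coloring Leaf c (\<lambda>_. x) \<and> (\<forall>e \<in> edges Leaf. x \<noteq> 0)"
    by (simp add: induced_coloring_iff)
  then show "valid Leaf c"
    using \<open>c = [x]\<close> by (auto simp: valid_iff_nonzero)
qed

text \<open>
  Validity becomes a recursion on the tree in which only the color of the edge at the root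
  has to be checked at each step.
\<close>

lemma valid_Node:
  "valid (Node l u r) c \<longleftrightarrow> (\<exists>a b. c = a @ b \<and> valid l a \<and> valid r b \<and> sum_list c \<noteq> 0)"
proof
  assume "valid (Node l u r) c"
  then obtain f where f: "induced_coloring (Node l u r) c f" "\<forall>e \<in> edges (Node l u r). f e \<noteq> 0"
    and lc: "length c = size l + 1 + (size r + 1)"
    by (auto simp: valid_iff_nonzero)
  define a b where "a = take (size l + 1) c" and "b = drop (size l + 1) c"
  have len: "length a = size l + 1" "length b = size r + 1" and c: "c = a @ b"
    using lc by (auto simp: a_def b_def)
  have "valid l a" "valid r b"
    using f len unfolding c induced_coloring_Node[OF len(1)]
    by (auto simp: valid_iff_nonzero edges_Node)
  moreover have "sum_list c \<noteq> 0"
    using f induced_coloring_root[OF f(1)] by (auto simp: edges_Node)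
  ultimately show "\<exists>a b. c = a @ b \<and> valid l a \<and> valid r b \<and> sum_list c \<noteq> 0"
    using c by blast
next
  assume "\<exists>a b. c = a @ b \<and> valid l a \<and> valid r b \<and> sum_list c \<noteq> 0"
  then obtain a b where c: "c = a @ b" and ab: "valid l a" "valid r b" and nz: "sum_list c \<noteq> 0"
    by blast
  from ab obtain f g where f: "induced_coloring l a f" "\<forall>e \<in> edges l. f e \<noteq> 0"
    and g: "induced_coloring r b g" "\<forall>e \<in> edges r. g e \<noteq> 0"
    and len: "length a = size l + 1" "length b = size r + 1"
    by (auto simp: valid_iff_nonzero)
  define h where "h e = (case e of [] \<Rightarrow> f [] + g [] | b # e' \<Rightarrow> if b then g e' else f e')" for e
  have "induced_coloring (Node l u r) c h"
    using f(1) g(1) unfolding c induced_coloring_Node[OF len(1)] by (simp add: h_def add.assoc color_add_eq_0_iff)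
  moreover have "\<forall>e \<in> edges (Node l u r). h e \<noteq> 0"
    using f g nz induced_coloring_root[OF f(1)] induced_coloring_root[OF g(1)]
    by (auto simp: edges_Node h_def c)
  ultimately show "valid (Node l u r) c"
    using len c by (auto simp: valid_iff_nonzero)
qed

section \<open>Acceptable vectors\<close>

definition monochromatic :: "'a list \<Rightarrow> bool" where
  "monochromatic c \<longleftrightarrow> (\<exists>z. set c \<subseteq> {z})"

lemma not_monochromatic_adjacent:
  "\<not> monochromatic c \<Longrightarrow> \<exists>u x y v. c = u @ [x, y] @ v \<and> x \<noteq> y"
proof (induction c)
  case Nil
  then show ?case by (simp add: monochromatic_def)
next
  case (Cons x c)
  show ?case
  proof (cases "monochromatic c")
    case False
    with Cons.IH show ?thesis by (metis append_Cons)
  next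
    case True
    then obtain z where z: "set c \<subseteq> {z}" by (auto simp: monochromatic_def)
    with Cons.prems obtain d where "c = z # d" "x \<noteq> z"
      by (cases c) (auto simp: monochromatic_def)
    then show ?thesis by (metis append_Cons append_Nil)
  qed
qed

text \<open>
  If a vector \<open>a @ b\<close> split at the root were constant, then by induction both parts would have
  length 1, so \<open>a = b = [z]\<close> and the sum \<open>z + z\<close> would vanish.
\<close>

lemma valid_imp:
  "valid t c \<Longrightarrow> set c \<subseteq> colors123 \<and> sum_list c \<noteq> 0 \<and> (length c = 1 \<or> \<not> monochromatic c)"
proof (induction t arbitrary: c)
  case Leaf
  then show ?case by (auto simp: valid_Leaf colors123_eq)
next
  case (Node l u r)
  then obtain a b where c: "c = a @ b" and nz: "sum_list c \<noteq> 0"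
    and a: "set a \<subseteq> colors123" "length a = 1 \<or> \<not> monochromatic a"
    and b: "set b \<subseteq> colors123" "length b = 1 \<or> \<not> monochromatic b"
    unfolding valid_Node by blast
  have "\<not> monochromatic c"
  proof
    assume "monochromatic c"
    then obtain z where z: "set a \<subseteq> {z}" "set b \<subseteq> {z}" by (auto simp: monochromatic_def c)
    then have "length a = 1" "length b = 1" using a b by (auto simp: monochromatic_def)
    with z have "a = [z]" "b = [z]" by (auto simp: length_Suc_conv)
    with nz c show False by simp
  qed
  with c nz a b show ?case by auto
qed

text \<open>
  For \<open>t'\<close> take \<open>t\<close> with a caret attached to the leaf colored \<open>x + y\<close>; the colors of the old
  edges do not change.
\<close>

lemma acceptable_graft:
  assumes "valid t (u @ [x + y] @ v)" "x \<noteq> 0" "y \<noteq> 0"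
  shows "\<exists>t'. valid t' (u @ [x, y] @ v)"
  using assms(1)
proof (induction t arbitrary: u v)
  case Leaf
  then have "u = []" "v = []" "x + y \<noteq> 0" by (auto simp: valid_Leaf append_eq_Cons_conv)
  moreover have "valid Leaf [x]" "valid Leaf [y]" using assms by (simp_all add: valid_Leaf)
  ultimately have "valid (Node Leaf () Leaf) (u @ [x, y] @ v)"
    unfolding valid_Node by (intro exI[of _ "[x]"] exI[of _ "[y]"]) simp
  then show ?case by blast
next
  case (Node l w r)
  then obtain a b where ab: "u @ [x + y] @ v = a @ b" "valid l a" "valid r b"
    and nz: "sum_list (u @ [x + y] @ v) \<noteq> 0"
    unfolding valid_Node by blast
  have nz': "sum_list (u @ [x, y] @ v) \<noteq> 0" using nz by (simp add: add.assoc)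
  from ab(1) consider v' where "a = u @ [x + y] @ v'" "v = v' @ b"
    | u' where "b = u' @ [x + y] @ v" "u = a @ u'"
    by (auto simp: append_eq_append_conv2 Cons_eq_append_conv append_eq_Cons_conv)
  then show ?case
  proof cases
    case 1
    with ab Node.IH(1) obtain t' where "valid t' (u @ [x, y] @ v')" by blast
    then have "valid (Node t' w r) (u @ [x, y] @ v)"
      unfolding valid_Node using nz' 1 ab
      by (intro exI[of _ "u @ [x, y] @ v'"] exI[of _ b]) auto
    then show ?thesis by blast
  next
    case 2
    with ab Node.IH(2) obtain t' where "valid t' (u' @ [x, y] @ v)" by blast
    then have "valid (Node l w t') (u @ [x, y] @ v)"
      unfolding valid_Node using nz' 2 ab
      by (intro exI[of _ a] exI[of _ "u' @ [x, y] @ v"]) auto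
    then show ?thesis by blast
  qed
qed

text \<open>
  Merging an adjacent pair \<open>x \<noteq> y\<close> into \<open>z = x + y\<close> is bad only if all other entries are \<open>z\<close>. Then
  one of the two entries has a neighbor \<open>z\<close>, and merging it with that neighbor instead creates an
  entry equal to the other one of \<open>x\<close> and \<open>y\<close>. This is bad again only if no further entry \<open>z\<close> is
  left, and then the vector consists of the three colors and has sum 0.
\<close>

lemma ex_good_merge:
  assumes "\<not> monochromatic c" "set c \<subseteq> colors123" "sum_list c \<noteq> 0"
  obtains u x y v where "c = u @ [x, y] @ v" "x \<noteq> y"
    "length (u @ [x + y] @ v) = 1 \<or> \<not> monochromatic (u @ [x + y] @ v)"
proof -
  obtain u x y v where c: "c = u @ [x, y] @ v" and xy: "x \<noteq> y"
    using not_monochromatic_adjacent assms(1) by blast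
  define z where "z = x + y"
  have nz: "x \<noteq> 0" "y \<noteq> 0" using assms(2) by (auto simp: c colors123_eq)
  then have z: "z \<noteq> x" "z \<noteq> y" "z + x = y" "y + z = x" "x + (y + z) = 0"
    by (auto simp: z_def add.commute add.left_commute)
  \<comment> \<open>The last two cases overlap; they say on which side of the pair a neighbor \<open>z\<close> exists.\<close>
  consider "length (u @ [x + y] @ v) = 1 \<or> \<not> monochromatic (u @ [x + y] @ v)"
    | "u \<noteq> []" "set u \<subseteq> {z}" "set v \<subseteq> {z}" | "v \<noteq> []" "set u \<subseteq> {z}" "set v \<subseteq> {z}"
    by (auto simp: monochromatic_def z_def)
  then show thesis
  proof cases
    case 1
    then show ?thesis using that c xy by blast
  next
    case 2
    then obtain u' where u: "u = u' @ [z]" by (cases u rule: rev_cases) auto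
    have "\<not> monochromatic (u' @ [z + x] @ y # v)"
    proof
      assume "monochromatic (u' @ [z + x] @ y # v)"
      then have "set u' \<subseteq> {y}" "set v \<subseteq> {y}" by (auto simp: monochromatic_def)
      with 2 z u have "u' = []" "v = []" by (cases u'; cases v; auto)+
      then show False using assms(3) z by (simp add: c u add.commute add.left_commute)
    qed
    then show ?thesis using that[of u' z x "y # v"] z by (simp add: c u)
  next
    case 3
    then obtain v' where v: "v = z # v'" by (cases v) auto
    have "\<not> monochromatic ((u @ [x]) @ [y + z] @ v')"
    proof
      assume "monochromatic ((u @ [x]) @ [y + z] @ v')"
      then have "set u \<subseteq> {x}" "set v' \<subseteq> {x}" by (auto simp: monochromatic_def)
      with 3 z v have "u = []" "v' = []" by (cases u; cases v'; auto)+
      then show False using assms(3) z by (simp add: c v)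
    qed
    then show ?thesis using that[of "u @ [x]" y z v'] z by (simp add: c v)
  qed
qed

lemma acceptable_if:
  "set c \<subseteq> colors123 \<Longrightarrow> sum_list c \<noteq> 0 \<Longrightarrow> length c = 1 \<or> \<not> monochromatic c \<Longrightarrow> acceptable c"
proof (induction "length c" arbitrary: c rule: less_induct)
  case less
  show ?case
  proof (cases "length c = 1")
    case True
    then obtain x where "c = [x]" by (auto simp: length_Suc_conv)
    with less.prems have "valid Leaf c" by (auto simp: valid_Leaf)
    then show ?thesis by (auto simp: acceptable_def)
  next
    case False
    with less.prems obtain u x y v where c: "c = u @ [x, y] @ v" and xy: "x \<noteq> y"
      and m: "length (u @ [x + y] @ v) = 1 \<or> \<not> monochromatic (u @ [x + y] @ v)"
      using ex_good_merge by metis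
    have nz: "x \<noteq> 0" "y \<noteq> 0" using less.prems(1) by (auto simp: c colors123_eq)
    have "acceptable (u @ [x + y] @ v)"
    proof (rule less.hyps)
      show "sum_list (u @ [x + y] @ v) \<noteq> 0"
        using less.prems(2) by (simp add: c add.assoc)
      show "set (u @ [x + y] @ v) \<subseteq> colors123"
        using less.prems(1) xy by (auto simp: c colors123_eq color_add_eq_0_iff)
    qed (use m in \<open>auto simp: c\<close>)
    then show ?thesis using acceptable_graft nz unfolding acceptable_def c by blast
  qed
qed

definition nonconstant_nonzero :: "nat \<Rightarrow> color list set" where
  "nonconstant_nonzero m =
     {c. length c = m \<and> set c \<subseteq> colors123 \<and> sum_list c \<noteq> 0 \<and> \<not> monochromatic c}"

text \<open>
  The convention at 0 agrees with the general formula, since a vector of length 1 is constant.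
\<close>

lemma num_acceptable_eq:
  "num_acceptable n = card (S3_orbit ` nonconstant_nonzero (n + 1))"
proof (cases "n = 0")
  case True
  have "nonconstant_nonzero (0 + 1) = {}"
    by (auto simp: nonconstant_nonzero_def monochromatic_def length_Suc_conv)
  then show ?thesis using True by (simp add: num_acceptable_def)
next
  case False
  then have "{c. length c = n + 1 \<and> acceptable c} = nonconstant_nonzero (n + 1)"
    unfolding nonconstant_nonzero_def
    using acceptable_if valid_imp by (fastforce simp: acceptable_def)
  then show ?thesis using False by (simp add: num_acceptable_def)
qed

section \<open>The action of the symmetric group\<close>

text \<open>
  The automorphism group of the Klein four-group is the full symmetric group on the non-zero
  elements: for distinct non-zero \<open>x\<close> and \<open>y\<close>, both sides are the third color besides \<open>\<sigma> x\<close> and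
  \<open>\<sigma> y\<close>.
\<close>

lemma permutes_colors_add:
  assumes "\<sigma> permutes colors123"
  shows "\<sigma> (x + y) = \<sigma> x + \<sigma> y"
proof -
  have inj: "\<sigma> a = \<sigma> b \<longleftrightarrow> a = b" for a b
    using permutes_inj[OF assms] by (auto dest: injD)
  have 0: "\<sigma> 0 = 0" using assms by (simp add: permutes_def colors123_eq)
  show ?thesis
  proof (cases "x = 0 \<or> y = 0 \<or> x = y")
    case True
    then show ?thesis using 0 by auto
  next
    case False
    then have "x + y \<noteq> 0" "x \<noteq> x + y" "y \<noteq> x + y" by (auto simp: color_add_eq_0_iff)
    with False have "\<sigma> x + \<sigma> y = \<sigma> (x + y)"
      using inj[of _ 0] by (intro third_color) (auto simp: inj 0)
    then show ?thesis by simp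
  qed
qed

lemma permutes_colors_sum_list:
  assumes "\<sigma> permutes colors123"
  shows "sum_list (map \<sigma> c) = \<sigma> (sum_list c)"
proof (induction c)
  case Nil
  show ?case using assms by (simp add: permutes_def colors123_eq)
qed (simp add: permutes_colors_add[OF assms])

lemma monochromatic_iff: "monochromatic c \<longleftrightarrow> (\<forall>x \<in> set c. \<forall>y \<in> set c. x = y)"
  unfolding monochromatic_def by blast

lemma monochromatic_map_inj: "inj f \<Longrightarrow> monochromatic (map f c) \<longleftrightarrow> monochromatic c"
  by (simp add: monochromatic_iff inj_eq)

lemma S3_orbit_subset:
  assumes "c \<in> nonconstant_nonzero m"
  shows "S3_orbit c \<subseteq> nonconstant_nonzero m"
proof
  fix d assume "d \<in> S3_orbit c"
  then obtain \<sigma> where d: "d = map \<sigma> c" and \<sigma>: "\<sigma> permutes colors123"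
    by (auto simp: S3_orbit_def)
  have "sum_list d \<noteq> 0"
    using assms permutes_in_image[OF \<sigma>, of "sum_list c"]
    by (auto simp: d permutes_colors_sum_list[OF \<sigma>] nonconstant_nonzero_def colors123_eq)
  moreover have "set d \<subseteq> colors123"
    using assms permutes_in_image[OF \<sigma>] by (auto simp: d nonconstant_nonzero_def)
  ultimately show "d \<in> nonconstant_nonzero m"
    using assms monochromatic_map_inj[OF permutes_inj[OF \<sigma>]] by (auto simp: nonconstant_nonzero_def d)
qed

lemma S3_orbit_self: "c \<in> S3_orbit c"
  using permutes_id[of colors123] by (auto simp: S3_orbit_def intro!: exI[of _ id])

lemma S3_orbit_eq:
  assumes "d \<in> S3_orbit c"
  shows "S3_orbit d = S3_orbit c"
proof -
  obtain \<sigma> where d: "d = map \<sigma> c" and \<sigma>: "\<sigma> permutes colors123"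
    using assms by (auto simp: S3_orbit_def)
  have c: "c = map (inv \<sigma>) d"
    by (simp add: d permutes_inv_o(2)[OF \<sigma>])
  have "map \<tau> d \<in> S3_orbit c" if "\<tau> permutes colors123" for \<tau>
    using permutes_compose[OF \<sigma> that] by (force simp: S3_orbit_def d simp del: map_eq_conv)
  moreover have "map \<tau> c \<in> S3_orbit d" if "\<tau> permutes colors123" for \<tau>
    unfolding c using permutes_compose[OF permutes_inv[OF \<sigma>] that]
    by (force simp: S3_orbit_def simp del: map_eq_conv)
  ultimately show ?thesis by (auto simp: S3_orbit_def[of c] S3_orbit_def[of d])
qed

text \<open>
  The stabilizer is trivial: two distinct entries \<open>x\<close> and \<open>y\<close> generate the group of colors, so an
  additive map is determined by its values on them.
\<close>

lemma card_S3_orbit: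
  assumes "c \<in> nonconstant_nonzero m"
  shows "card (S3_orbit c) = 6"
proof -
  obtain x y where xy: "x \<in> set c" "y \<in> set c" "x \<noteq> y" "x \<in> colors123" "y \<in> colors123"
    using assms not_monochromatic_adjacent[of c] by (force simp: nonconstant_nonzero_def)
  have "inj_on (\<lambda>\<sigma>. map \<sigma> c) {\<sigma>. \<sigma> permutes colors123}"
  proof (rule inj_onI, clarify)
    fix \<sigma> \<tau> assume \<sigma>: "\<sigma> permutes colors123" and \<tau>: "\<tau> permutes colors123"
      and "map \<sigma> c = map \<tau> c"
    then have eq: "\<sigma> x = \<tau> x" "\<sigma> y = \<tau> y" using xy by auto
    show "\<sigma> = \<tau>"
    proof
      fix w
      have "w \<in> {0, x, y, x + y}"
        using third_color[of x y w] xy by (auto simp: colors123_eq)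
      moreover have "\<sigma> 0 = 0" "\<tau> 0 = 0"
        using \<sigma> \<tau> by (auto simp: permutes_def colors123_eq)
      ultimately show "\<sigma> w = \<tau> w"
        using eq by (auto simp: permutes_colors_add[OF \<sigma>] permutes_colors_add[OF \<tau>])
    qed
  qed
  moreover have "card {\<sigma>. \<sigma> permutes colors123} = 6"
    using card_permutations[OF card_colors123] by (simp add: fact_numeral)
  moreover have "S3_orbit c = (\<lambda>\<sigma>. map \<sigma> c) ` {\<sigma>. \<sigma> permutes colors123}"
    by (auto simp: S3_orbit_def)
  ultimately show ?thesis by (simp add: card_image)
qed

lemma finite_color_lists: "finite {c. length c = m \<and> set c \<subseteq> colors123 \<and> P c}"
  by (rule finite_subset[OF _ finite_lists_length_eq[OF card_colors123(2), of m]]) auto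

lemma num_acceptable_card: "6 * num_acceptable n = card (nonconstant_nonzero (n + 1))"
proof -
  let ?X = "nonconstant_nonzero (n + 1)"
  have U: "\<Union> (S3_orbit ` ?X) = ?X"
    using S3_orbit_subset S3_orbit_self by blast
  have fin: "finite ?X" unfolding nonconstant_nonzero_def by (rule finite_color_lists)
  have "6 * card (S3_orbit ` ?X) = card (\<Union> (S3_orbit ` ?X))"
  proof (rule card_partition)
    fix A B assume "A \<in> S3_orbit ` ?X" "B \<in> S3_orbit ` ?X" "A \<noteq> B"
    then show "A \<inter> B = {}" using S3_orbit_eq by blast
  qed (use fin U card_S3_orbit in auto)
  then show ?thesis by (simp only: U num_acceptable_eq)
qed

section \<open>Counting\<close>

definition nonzero_sum :: "nat \<Rightarrow> color list set" where
  "nonzero_sum m = {c. length c = m \<and> set c \<subseteq> colors123 \<and> sum_list c \<noteq> 0}"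

text \<open>
  Prepending its sum to a vector turns the vectors of length \<open>m\<close> with non-zero sum bijectively into
  the vectors of length \<open>m + 1\<close> with sum 0; these and the ones with non-zero sum together are all
  \<open>3 ^ (m + 1)\<close> vectors.
\<close>

lemma card_nonzero_sum_Suc: "card (nonzero_sum (Suc m)) + card (nonzero_sum m) = 3 ^ Suc m"
proof -
  let ?Z = "{c. length c = Suc m \<and> set c \<subseteq> colors123 \<and> sum_list c = 0}"
  have "?Z = (\<lambda>c. sum_list c # c) ` nonzero_sum m"
  proof (intro equalityI subsetI)
    fix c assume "c \<in> ?Z"
    then obtain x d where "c = x # d" "length d = m" "x \<noteq> 0" "set d \<subseteq> colors123" "x = sum_list d"
      by (auto simp: length_Suc_conv color_add_eq_0_iff colors123_eq)
    then show "c \<in> (\<lambda>c. sum_list c # c) ` nonzero_sum m" by (auto simp: nonzero_sum_def)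
  qed (auto simp: nonzero_sum_def colors123_eq)
  then have "card ?Z = card (nonzero_sum m)"
    by (simp add: card_image inj_on_def)
  moreover have "{c. set c \<subseteq> colors123 \<and> length c = Suc m} = nonzero_sum (Suc m) \<union> ?Z"
    by (auto simp: nonzero_sum_def)
  moreover have "card (nonzero_sum (Suc m) \<union> ?Z) = card (nonzero_sum (Suc m)) + card ?Z"
    unfolding nonzero_sum_def
    by (rule card_Un_disjoint[OF finite_color_lists finite_color_lists]) auto
  moreover have "card {c. set c \<subseteq> colors123 \<and> length c = Suc m} = 3 ^ Suc m"
    using card_lists_length_eq[OF card_colors123(2)] by (simp add: card_colors123)
  ultimately show ?thesis by simp
qed

lemma card_nonzero_sum_split:
  assumes "m \<ge> 1"
  shows "card (nonzero_sum m) = card (nonconstant_nonzero m) + (if odd m then 3 else 0)"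
proof -
  let ?C = "if odd m then replicate m ` colors123 else {}"
  have rep: "monochromatic c \<longleftrightarrow> (\<exists>x. c = replicate (length c) x)" for c :: "color list"
  proof
    assume "monochromatic c"
    then obtain z where "\<forall>y \<in> set c. y = z" by (auto simp: monochromatic_def)
    then show "\<exists>x. c = replicate (length c) x" using replicate_length_same by metis
  next
    assume "\<exists>x. c = replicate (length c) x"
    then show "monochromatic c"
      unfolding monochromatic_def by (metis in_set_replicate singletonI subsetI)
  qed
  have "nonzero_sum m = nonconstant_nonzero m \<union> ?C"
  proof (intro equalityI subsetI)
    fix c assume c: "c \<in> nonzero_sum m"
    show "c \<in> nonconstant_nonzero m \<union> ?C"
    proof (cases "monochromatic c")
      case True
      then obtain x where "c = replicate m x" using c rep by (auto simp: nonzero_sum_def)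
      then show ?thesis using c assms
        by (auto simp: nonzero_sum_def sum_list_replicate_color split: if_splits)
    qed (use c in \<open>auto simp: nonzero_sum_def nonconstant_nonzero_def\<close>)
  qed (use assms in \<open>auto simp: nonzero_sum_def nonconstant_nonzero_def sum_list_replicate_color
        colors123_eq split: if_splits\<close>)
  moreover have "nonconstant_nonzero m \<inter> ?C = {}"
    by (auto simp: nonconstant_nonzero_def rep)
  moreover have "card ?C = (if odd m then 3 else 0)"
    using assms by (auto simp: card_image inj_on_def card_colors123)
  moreover have "finite (nonconstant_nonzero m)"
    unfolding nonconstant_nonzero_def by (rule finite_color_lists)
  moreover have "finite ?C" by (simp add: card_colors123)
  ultimately show ?thesis by (simp only: card_Un_disjoint)
qed

theorem proposition15p3:
  "num_acceptable 0 = 0 \<and>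
   num_acceptable 1 = 1 \<and>
   (\<forall>n \<ge> 1. num_acceptable (n + 1) = 2 * num_acceptable n + 3 * num_acceptable (n - 1) + 1)"
proof -
  have N: "6 * num_acceptable n + (if even n then 3 else 0) = card (nonzero_sum (Suc n))" for n
    using card_nonzero_sum_split[of "Suc n"] num_acceptable_card[of n] by simp
  have zero: "num_acceptable 0 = 0" by (simp add: num_acceptable_def)
  have one: "num_acceptable 1 = 1"
    using card_nonzero_sum_Suc[of 1] N[of 0] N[of 1] zero by simp
  have "num_acceptable (n + 1) = 2 * num_acceptable n + 3 * num_acceptable (n - 1) + 1"
    if "n \<ge> 1" for n
  proof -
    obtain k where k: "n = Suc k" using \<open>n \<ge> 1\<close> by (cases n) auto
    \<comment> \<open>The two instances share \<open>card (nonzero_sum (k + 2))\<close>; subtracting three times the first from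
      the second eliminates the powers of 3.\<close>
    show ?thesis
      using card_nonzero_sum_Suc[of "Suc k"] card_nonzero_sum_Suc[of "Suc (Suc k)"]
        N[of k] N[of "Suc k"] N[of "Suc (Suc k)"]
      by (cases "even k") (auto simp: k)
  qed
  with zero one show ?thesis by blast
qed

end
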